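(* Given a (proper) $\chi$-coloring of the conflict graph $G$ of the instance, Algorithm $\mathcal{B}$ is a $\chi$-approximation algorithm for $mRmD$ instances with the same starting location for every resource.
   Context: Problem $mRmD$ (heterogeneous multi-resource allocation with subset demand requests). An instance consists of: a finite set $D$ of demands; a finite set $R$ of resource types; for each $r\in R$ a finite set $S^r$ of starting locations and, for each $s\in S^r$, a number $l_s^r$ of resources of type $r$ starting at $s$; for each demand $d\in D$ a nonempty set $M_d\subseteq R$ of required resource types, a service start time $\tau_d\ge 0$, a service duration $\Delta_d>0$ and a reward $w_d\ge 0$; and travel times $f_{xy}\ge 0$ between any two locations ($f_{ij}$ is the travel time between the locations of demands $i$ and $j$, and $f_{sd}$ that from starting location $s$ to the location of demand $d$). All these numbers are integers. Demand $d$ requires one unit of every resource type in $M_d$ simultaneously at time $\tau_d$ for duration $\Delta_d$. A resource of type $r$ starting at $s\in S^r$ can serve $d$ as its first demand iff $r\in M_d$ and $f_{sd}\le\tau_d$; a resource of type $r$ can serve $j$ immediately after $i$ iff $r\in M_i\cap M_j$ and $\tau_i+\Delta_i+f_{ij}\le\tau_j$. A feasible solution assigns to each resource a (possibly empty) path, i.e. a sequence of demands whose first element can be served first and in which each consecutive pair can be served one immediately after the other. Demand $d$ is met if, for every $r\in M_d$, at least one resource of type $r$ has $d$ on its path. The objective is to maximize the sum of $w_d$ over met demands $d$. An $\alpha$-approximation algorithm ($\alpha\ge 1$) is an algorithm that, for every instance, returns a feasible solution with objective value at least $\frac1\alpha$ times the optimal objective value, in time polynomial in the size of the instance. Resource types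 are labeled $1,\dots,|R|$ so that $m_1\le m_2\le\dots\le m_{|R|}$, where $m_r$ is the number of resources of type $r$. The conflict graph $G=(V,E)$ has one node for each distinct set among the $M_j$, $j\in D$ (nodes are identified with these subsets of $R$), and two distinct nodes $u,v$ are adjacent iff $u\cap v\ne\emptyset$. For $v\in V$ let $\bar D^v=\{d\in D: M_d=v\}$, and let $1R1\bar D^v$ be the single-resource-type problem whose resources are all resources of type $i$, where $i$ is the smallest index in $v$, and whose demands are $\bar D^v$, each regarded as requiring only type $i$; it can be solved to optimality in polynomial time. Algorithm $\mathcal{B}$ (input: the instance, $G$, and a $\chi$-coloring of $G$ with colors $1,\dots,\chi$, $S_i$ being the set of nodes of color $i$): for each color $i$ and each $v\in S_i$ solve $1R1\bar D^v$ optimally, with optimal value $\mathcal{B}_v$. Choose a color $i$ maximizing $\sum_{v\in S_i}\mathcal{B}_v$ and output this value, together with the corresponding solution: for every $v\in S_i$, the demands met in the optimal solution of $1R1\bar D^v$ are served, resources of every other type in $v$ following the schedules of the resources of the smallest-index type in that solution.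
   Formalization: Travel times are additionally assumed to satisfy the triangle inequality on the locations of the instance; for arbitrary nonnegative travel times the claim fails (a path a,b,c may be feasible while a,c is not, giving optimum 3 but output 1 with a 2-coloring). *)

theory Defs
  imports
    Complex_Main
    "HOL-Library.Log_Nat"
    "HOL-Library.Monad_Syntax"
    "HOL-Computational_Algebra.Polynomial"
begin

section \<open>Instances, feasible solutions, optimum\<close>

text \<open>
  All numerical data are natural numbers, i.e. nonnegative integers. Every demand has a location,
  so that travel times between demands, and from starting locations to demands, are values of one
  function on locations. Resource types are represented by their labels.
\<close>

record ('d, 'l) mrmd =
  demands  :: "'d set"
  types    :: "nat set"
  starts   :: "nat \<Rightarrow> 'l set"
  num      :: "nat \<Rightarrow> 'l \<Rightarrow> nat"
  req      :: "'d \<Rightarrow> nat set"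
  tau      :: "'d \<Rightarrow> nat"
  duration :: "'d \<Rightarrow> nat"
  reward   :: "'d \<Rightarrow> nat"
  loc      :: "'d \<Rightarrow> 'l"
  travel   :: "'l \<Rightarrow> 'l \<Rightarrow> nat"

definition mrmd_instance :: "('d, 'l) mrmd \<Rightarrow> bool" where
  "mrmd_instance I \<longleftrightarrow>
     finite (demands I) \<and> finite (types I) \<and> (\<forall>r\<in>types I. finite (starts I r)) \<and>
     (\<forall>d\<in>demands I. req I d \<noteq> {} \<and> req I d \<subseteq> types I \<and> duration I d > 0)"

definition locations :: "('d, 'l) mrmd \<Rightarrow> 'l set" where
  "locations I = loc I ` demands I \<union> (\<Union>r\<in>types I. starts I r)"

text \<open>\<open>(r, s, k)\<close> is the \<open>k\<close>-th resource of type \<open>r\<close> starting at \<open>s\<close>.\<close>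

type_synonym 'l resource = "nat \<times> 'l \<times> nat"

definition resources :: "('d, 'l) mrmd \<Rightarrow> 'l resource set" where
  "resources I = {(r, s, k). r \<in> types I \<and> s \<in> starts I r \<and> k < num I r s}"

definition num_resources :: "('d, 'l) mrmd \<Rightarrow> nat \<Rightarrow> nat" where
  "num_resources I r = (\<Sum>s\<in>starts I r. num I r s)"

definition can_serve_first :: "('d, 'l) mrmd \<Rightarrow> nat \<Rightarrow> 'l \<Rightarrow> 'd \<Rightarrow> bool" where
  "can_serve_first I r s d \<longleftrightarrow> r \<in> req I d \<and> travel I s (loc I d) \<le> tau I d"

definition can_serve_next :: "('d, 'l) mrmd \<Rightarrow> nat \<Rightarrow> 'd \<Rightarrow> 'd \<Rightarrow> bool" where
  "can_serve_next I r i j \<longleftrightarrow>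
     r \<in> req I i \<inter> req I j \<and> tau I i + duration I i + travel I (loc I i) (loc I j) \<le> tau I j"

fun is_path :: "('d, 'l) mrmd \<Rightarrow> 'l resource \<Rightarrow> 'd list \<Rightarrow> bool" where
  "is_path I (r, s, k) p \<longleftrightarrow>
     set p \<subseteq> demands I \<and> (p \<noteq> [] \<longrightarrow> can_serve_first I r s (hd p)) \<and>
     successively (can_serve_next I r) p"

definition feasible :: "('d, 'l) mrmd \<Rightarrow> ('l resource \<Rightarrow> 'd list) \<Rightarrow> bool" where
  "feasible I \<sigma> \<longleftrightarrow> (\<forall>\<rho>\<in>resources I. is_path I \<rho> (\<sigma> \<rho>))"

definition met :: "('d, 'l) mrmd \<Rightarrow> ('l resource \<Rightarrow> 'd list) \<Rightarrow> 'd \<Rightarrow> bool" where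
  "met I \<sigma> d \<longleftrightarrow>
     (\<forall>r\<in>req I d. \<exists>s k. (r, s, k) \<in> resources I \<and> d \<in> set (\<sigma> (r, s, k)))"

definition objective :: "('d, 'l) mrmd \<Rightarrow> ('l resource \<Rightarrow> 'd list) \<Rightarrow> nat" where
  "objective I \<sigma> = (\<Sum>d | d \<in> demands I \<and> met I \<sigma> d. reward I d)"

definition opt :: "('d, 'l) mrmd \<Rightarrow> nat" where
  "opt I = Max {objective I \<sigma> | \<sigma>. feasible I \<sigma>}"

text \<open>
  Resource types are labelled \<open>1, \<dots>, |R|\<close> by nondecreasing number of resources.
\<close>

definition sorted_labels :: "('d, 'l) mrmd \<Rightarrow> bool" where
  "sorted_labels I \<longleftrightarrow>
     types I = {1..card (types I)} \<and>
     (\<forall>r\<in>types I. \<forall>r'\<in>types I. r \<le> r' \<longrightarrow> num_resources I r \<le> num_resources I r')"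

definition same_start :: "('d, 'l) mrmd \<Rightarrow> bool" where
  "same_start I \<longleftrightarrow> (\<exists>s\<^sub>0. \<forall>(r, s, k)\<in>resources I. s = s\<^sub>0)"

text \<open>
  Under the triangle inequality a path stays a path when demands are dropped from it. Without it,
  the value of a node's subproblem need not bound what a feasible solution earns on that node.
\<close>

definition triangle_inequality :: "('d, 'l) mrmd \<Rightarrow> bool" where
  "triangle_inequality I \<longleftrightarrow>
     (\<forall>x\<in>locations I. \<forall>y\<in>locations I. \<forall>z\<in>locations I.
        travel I x z \<le> travel I x y + travel I y z)"


section \<open>Conflict graph and colorings\<close>

text \<open>A graph is a pair of a vertex set and a set of two-element edges.\<close>

definition conflict_graph :: "('d, 'l) mrmd \<Rightarrow> nat set set \<times> nat set set set" where
  "conflict_graph I =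
     (let V = req I ` demands I in (V, {{u, v} | u v. u \<in> V \<and> v \<in> V \<and> u \<noteq> v \<and> u \<inter> v \<noteq> {}}))"

fun proper_coloring :: "'v set \<times> 'v set set \<Rightarrow> nat \<Rightarrow> ('v \<Rightarrow> nat) \<Rightarrow> bool" where
  "proper_coloring (V, E) \<chi> c \<longleftrightarrow>
     (\<forall>v\<in>V. c v \<in> {1..\<chi>}) \<and> (\<forall>u v. {u, v} \<in> E \<longrightarrow> c u \<noteq> c v)"


section \<open>Single-resource-type subproblems\<close>

definition single_type :: "('d, 'l) mrmd \<Rightarrow> bool" where
  "single_type I \<longleftrightarrow> (\<exists>r. types I = {r})"

text \<open>
  For a node \<open>v\<close> and \<open>ds\<close> the set of demands whose requirement set is \<open>v\<close>, this is the problem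
  $1R1\bar D^v$: only the resources of the smallest type in \<open>v\<close> remain.
\<close>

definition subproblem :: "('d, 'l) mrmd \<Rightarrow> nat set \<Rightarrow> 'd set \<Rightarrow> ('d, 'l) mrmd" where
  "subproblem I v ds = I\<lparr>demands := ds, types := {Min v}, req := (\<lambda>_. {Min v})\<rparr>"


section \<open>Encoding sizes\<close>

text \<open>Numbers are written in binary; identifiers of demands, types and locations have size one.\<close>

definition bits :: "nat \<Rightarrow> nat" where
  "bits n = 1 + floorlog 2 n"

definition inst_size :: "('d, 'l) mrmd \<Rightarrow> nat" where
  "inst_size I =
     1 + card (types I) + (\<Sum>r\<in>types I. \<Sum>s\<in>starts I r. 1 + bits (num I r s)) +
     (\<Sum>d\<in>demands I. 1 + card (req I d) + bits (tau I d) + bits (duration I d) + bits (reward I d)) +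
     (\<Sum>x\<in>locations I. \<Sum>y\<in>locations I. bits (travel I x y))"

text \<open>
  The number of resources may be exponential in the size of the instance, so algorithms output
  schedules as association lists; a resource that is not listed has the empty path.
\<close>

type_synonym ('d, 'l) schedule = "('l resource \<times> 'd list) list"

definition wf_schedule :: "('d, 'l) mrmd \<Rightarrow> ('d, 'l) schedule \<Rightarrow> bool" where
  "wf_schedule I xs \<longleftrightarrow> distinct (map fst xs) \<and> set (map fst xs) \<subseteq> resources I"

definition assignment :: "('d, 'l) schedule \<Rightarrow> 'l resource \<Rightarrow> 'd list" where
  "assignment xs \<rho> = (case map_of xs \<rho> of None \<Rightarrow> [] | Some p \<Rightarrow> p)"

fun output_size :: "nat \<times> ('d, 'l) schedule \<Rightarrow> nat" where
  "output_size (z, xs) = bits z + (\<Sum>((r, s, k), p)\<leftarrow>xs. 1 + bits k + length p)"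


section \<open>Computations with running time\<close>

datatype 'a tm = TM (val: 'a) (time: nat)

definition bind_tm :: "'a tm \<Rightarrow> ('a \<Rightarrow> 'b tm) \<Rightarrow> 'b tm" where
  "bind_tm m f = TM (val (f (val m))) (time m + time (f (val m)))"

adhoc_overloading Monad_Syntax.bind \<rightleftharpoons> bind_tm

text \<open>\<open>charge n x\<close> returns \<open>x\<close> at cost \<open>n\<close>.\<close>

definition charge :: "nat \<Rightarrow> 'a \<Rightarrow> 'a tm" where
  "charge n x = TM x n"

text \<open>
  The length of the output is bounded separately because the cost monad, unlike a machine, does
  not force a computation to pay for writing its result.
\<close>

definition polynomial_time ::
  "'i set \<Rightarrow> ('i \<Rightarrow> nat) \<Rightarrow> ('o \<Rightarrow> nat) \<Rightarrow> ('i \<Rightarrow> 'o tm) \<Rightarrow> bool" where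
  "polynomial_time X isize osize A \<longleftrightarrow>
     (\<exists>p :: nat poly. \<forall>x\<in>X. time (A x) \<le> poly p (isize x) \<and> osize (val (A x)) \<le> poly p (isize x))"

text \<open>
  Algorithms return the value of a solution together with that solution. An algorithm may get
  additional input besides the instance; \<open>inst\<close> extracts the instance, and the running time is
  measured in the size of the instance alone. The ratio \<open>\<alpha>\<close> may depend on the input, but
  the polynomial bounding the running time may not.
\<close>

definition approximation_algorithm ::
  "('i \<Rightarrow> real) \<Rightarrow> 'i set \<Rightarrow> ('i \<Rightarrow> ('d, 'l) mrmd) \<Rightarrow> ('i \<Rightarrow> (nat \<times> ('d, 'l) schedule) tm) \<Rightarrow> bool" where
  "approximation_algorithm \<alpha> X inst A \<longleftrightarrow>
     (\<forall>x\<in>X. \<alpha> x \<ge> 1 \<and>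
        (case val (A x) of (z, xs) \<Rightarrow>
           wf_schedule (inst x) xs \<and>
           feasible (inst x) (assignment xs) \<and>
           z = objective (inst x) (assignment xs) \<and>
           real (objective (inst x) (assignment xs)) \<ge> 1 / \<alpha> x * real (opt (inst x)))) \<and>
     polynomial_time X (inst_size \<circ> inst) output_size A"

definition solves_single_type ::
  "(('d, 'l) mrmd \<Rightarrow> (nat \<times> ('d, 'l) schedule) tm) \<Rightarrow> bool" where
  "solves_single_type solve \<longleftrightarrow>
     (\<forall>J. mrmd_instance J \<and> single_type J \<longrightarrow>
        (case val (solve J) of (z, xs) \<Rightarrow>
           wf_schedule J xs \<and>
           feasible J (assignment xs) \<and>
           objective J (assignment xs) = opt J \<and>
           z = opt J)) \<and>
     polynomial_time {J. mrmd_instance J \<and> single_type J} inst_size output_size solve"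


section \<open>Algorithm B\<close>

text \<open>
  Arithmetic on numbers costs their bit lengths, and every step of a list traversal costs at least
  one. Finite sets are stored as increasing lists, so that the only access to a set is through
  \<^const>\<open>sorted_list_of_set\<close>, and the smallest element of a nonempty set is the head of its list.
\<close>

definition add_tm :: "nat \<Rightarrow> nat \<Rightarrow> nat tm" where
  "add_tm a b = charge (bits a + bits b) (a + b)"

definition leq_tm :: "nat \<Rightarrow> nat \<Rightarrow> bool tm" where
  "leq_tm a b = charge (bits a + bits b) (a \<le> b)"

fun list_eq_tm :: "'a list \<Rightarrow> 'a list \<Rightarrow> bool tm" where
  "list_eq_tm [] [] = charge 1 True"
| "list_eq_tm (x # xs) (y # ys) =
     (if x = y then do { b \<leftarrow> list_eq_tm xs ys; charge 1 b } else charge 1 False)"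
| "list_eq_tm _ _ = charge 1 False"

fun map_tm :: "('a \<Rightarrow> 'b tm) \<Rightarrow> 'a list \<Rightarrow> 'b list tm" where
  "map_tm f [] = charge 1 []"
| "map_tm f (x # xs) = do { y \<leftarrow> f x; ys \<leftarrow> map_tm f xs; charge 1 (y # ys) }"

fun filter_tm :: "('a \<Rightarrow> bool tm) \<Rightarrow> 'a list \<Rightarrow> 'a list tm" where
  "filter_tm P [] = charge 1 []"
| "filter_tm P (x # xs) =
     do { b \<leftarrow> P x; ys \<leftarrow> filter_tm P xs; charge 1 (if b then x # ys else ys) }"

fun concat_map_tm :: "('a \<Rightarrow> 'b list tm) \<Rightarrow> 'a list \<Rightarrow> 'b list tm" where
  "concat_map_tm f [] = charge 1 []"
| "concat_map_tm f (x # xs) =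
     do { ys \<leftarrow> f x; zs \<leftarrow> concat_map_tm f xs; charge (1 + length ys) (ys @ zs) }"

fun member_tm :: "'a \<Rightarrow> 'a list \<Rightarrow> bool tm" where
  "member_tm x [] = charge 1 False"
| "member_tm x (y # ys) =
     (if x = y then charge 1 True else do { b \<leftarrow> member_tm x ys; charge 1 b })"

fun remdups_tm :: "'a list \<Rightarrow> 'a list tm" where
  "remdups_tm [] = charge 1 []"
| "remdups_tm (x # xs) =
     do { b \<leftarrow> member_tm x xs; ys \<leftarrow> remdups_tm xs; charge 1 (if b then ys else x # ys) }"

text \<open>Writing down the subproblem costs its size.\<close>

definition subproblem_tm ::
  "('d::linorder, 'l) mrmd \<Rightarrow> nat set \<Rightarrow> ('d, 'l) mrmd tm" where
  "subproblem_tm I v = do {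
     ds \<leftarrow> filter_tm (\<lambda>d. list_eq_tm (sorted_list_of_set (req I d)) (sorted_list_of_set v))
             (sorted_list_of_set (demands I));
     let J = subproblem I v (set ds);
     charge (inst_size J) J
   }"

text \<open>
  Solve the subproblems of the nodes in a list; the result is the sum of their optimal values
  together with the optimal schedule of each node.
\<close>

fun solve_nodes_tm ::
  "(('d::linorder, 'l) mrmd \<Rightarrow> (nat \<times> ('d, 'l) schedule) tm) \<Rightarrow> ('d, 'l) mrmd \<Rightarrow>
   nat set list \<Rightarrow> (nat \<times> (nat set \<times> ('d, 'l) schedule) list) tm" where
  "solve_nodes_tm solve I [] = charge 1 (0, [])"
| "solve_nodes_tm solve I (v # vs) = do {
     J \<leftarrow> subproblem_tm I v;
     (b, xs) \<leftarrow> solve J;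
     (t, sols) \<leftarrow> solve_nodes_tm solve I vs;
     t' \<leftarrow> add_tm b t;
     charge 1 (t', (v, xs) # sols)
   }"

text \<open>
  Among the given colors, take one with the largest sum. The pair \<open>(0, [])\<close> is returned only if
  there is no color.
\<close>

fun best_color_tm ::
  "(('d::linorder, 'l) mrmd \<Rightarrow> (nat \<times> ('d, 'l) schedule) tm) \<Rightarrow> ('d, 'l) mrmd \<Rightarrow>
   nat set list \<Rightarrow> (nat set \<Rightarrow> nat) \<Rightarrow> nat list \<Rightarrow>
   (nat \<times> (nat set \<times> ('d, 'l) schedule) list) tm" where
  "best_color_tm solve I vs c [] = charge 1 (0, [])"
| "best_color_tm solve I vs c (i # cs) = do {
     S \<leftarrow> filter_tm (\<lambda>v. charge 1 (c v = i)) vs;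
     cand \<leftarrow> solve_nodes_tm solve I S;
     best \<leftarrow> best_color_tm solve I vs c cs;
     b \<leftarrow> leq_tm (fst best) (fst cand);
     charge 1 (if b then cand else best)
   }"

text \<open>
  Every type \<open>r\<close> in \<open>v\<close> follows the schedule of the smallest type in \<open>v\<close>: if all resources start
  at the same location, the resource \<open>(r, s, k)\<close> exists whenever \<open>(Min v, s, k)\<close> does.
\<close>

fun copy_path_tm ::
  "nat \<Rightarrow> 'l resource \<times> 'd list \<Rightarrow> ('l resource \<times> 'd list) tm" where
  "copy_path_tm r ((i, s, k), p) = charge (1 + bits k + length p) ((r, s, k), p)"

fun replicate_schedule_tm :: "nat set \<times> ('d, 'l) schedule \<Rightarrow> ('d, 'l) schedule tm" where
  "replicate_schedule_tm (v, xs) =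
     concat_map_tm (\<lambda>r. map_tm (copy_path_tm r) xs) (sorted_list_of_set v)"

text \<open>
  The list \<open>vs\<close> enumerates the nodes of the conflict graph and \<open>c\<close> is the coloring. Only colors
  that occur are considered: a color without nodes contributes the sum 0.
\<close>

definition algorithm_B ::
  "(('d::linorder, 'l) mrmd \<Rightarrow> (nat \<times> ('d, 'l) schedule) tm) \<Rightarrow>
   ('d, 'l) mrmd \<Rightarrow> nat set list \<Rightarrow> (nat set \<Rightarrow> nat) \<Rightarrow> (nat \<times> ('d, 'l) schedule) tm" where
  "algorithm_B solve I vs c = do {
     cols \<leftarrow> map_tm (\<lambda>v. charge 1 (c v)) vs;
     cs \<leftarrow> remdups_tm cols;
     (z, sols) \<leftarrow> best_color_tm solve I vs c cs;
     xs \<leftarrow> concat_map_tm replicate_schedule_tm sols;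
     charge 1 (z, xs)
   }"

end

(* Restricting an optimal solution to the demands with requirement set v and to the resources of
   type Min v gives, by the triangle inequality, a solution of the subproblem of v; hence opt is
   at most the sum of the optima of all nodes, and some colour class carries a 1/\<chi> share of
   that sum. Conversely the nodes of one colour are pairwise disjoint, so their optimal schedules
   use disjoint sets of resources. They can be replicated to every type in v because the smallest
   label has the fewest resources and all resources start at the same place.

   The running time is polynomial since there are at most as many nodes and colours as demands
   and each subproblem is no larger than the instance. *)

theory Submission
  imports Defs
begin

section \<open>Computations\<close>

text \<open>For the upper bound any type of v could stand in place of \<open>Min v\<close>; copying
  fixes the choice, since the type with the fewest resources is the one that all others can imitate.
  The optima of all nodes cannot in general be realised together, because overlapping nodes compete
  for resources; the factor \<chi> is the price for keeping only one class of disjoint nodes. Since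
  the number of resources may be exponential in the size of the instance, schedules are treated
  entry by entry. In the running time, n bounds the size of the instance and q bounds the time and
  the output of \<open>solve\<close> on every node problem; q becomes a polynomial in the size of
  the instance only at the very end. The sums of optimal values are numbers too, so their bit
  lengths have to be controlled before the cost of adding and comparing them can be.\<close>

lemma val_bind_tm [simp]: "val (bind_tm m f) = val (f (val m))"
  and time_bind_tm [simp]: "time (bind_tm m f) = time m + time (f (val m))"
  by (simp_all add: bind_tm_def)

lemma val_charge [simp]: "val (charge n x) = x"
  and time_charge [simp]: "time (charge n x) = n"
  by (simp_all add: charge_def)

lemma val_add_tm [simp]: "val (add_tm a b) = a + b"
  and time_add_tm [simp]: "time (add_tm a b) = bits a + bits b"
  by (simp_all add: add_tm_def)

lemma val_leq_tm [simp]: "val (leq_tm a b) \<longleftrightarrow> a \<le> b"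
  and time_leq_tm [simp]: "time (leq_tm a b) = bits a + bits b"
  by (simp_all add: leq_tm_def)

lemma val_list_eq_tm [simp]: "val (list_eq_tm xs ys) \<longleftrightarrow> xs = ys"
  by (induction xs ys rule: list_eq_tm.induct) auto

lemma time_list_eq_tm: "time (list_eq_tm xs ys) \<le> 1 + length xs"
  by (induction xs ys rule: list_eq_tm.induct) auto

lemma val_map_tm [simp]: "val (map_tm f xs) = map (\<lambda>x. val (f x)) xs"
  by (induction xs) auto

lemma time_map_tm:
  assumes "\<And>x. x \<in> set xs \<Longrightarrow> time (f x) \<le> T"
  shows "time (map_tm f xs) \<le> 1 + length xs * (T + 1)"
  using assms
proof (induction xs)
  case (Cons x xs)
  have "time (f x) \<le> T" "time (map_tm f xs) \<le> 1 + length xs * (T + 1)"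
    using Cons by auto
  then show ?case by simp
qed simp

lemma val_filter_tm [simp]: "val (filter_tm P xs) = filter (\<lambda>x. val (P x)) xs"
  by (induction xs) auto

lemma time_filter_tm:
  assumes "\<And>x. x \<in> set xs \<Longrightarrow> time (P x) \<le> T"
  shows "time (filter_tm P xs) \<le> 1 + length xs * (T + 1)"
  using assms
proof (induction xs)
  case (Cons x xs)
  have "time (P x) \<le> T" "time (filter_tm P xs) \<le> 1 + length xs * (T + 1)"
    using Cons by auto
  then show ?case by simp
qed simp

lemma val_concat_map_tm [simp]:
  "val (concat_map_tm f xs) = concat (map (\<lambda>x. val (f x)) xs)"
  by (induction xs) auto

lemma time_concat_map_tm:
  assumes "\<And>x. x \<in> set xs \<Longrightarrow> time (f x) \<le> T"
    and "\<And>x. x \<in> set xs \<Longrightarrow> length (val (f x)) \<le> m"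
  shows "time (concat_map_tm f xs) \<le> 1 + length xs * (T + m + 1)"
  using assms
proof (induction xs)
  case (Cons x xs)
  have "time (f x) \<le> T" "length (val (f x)) \<le> m"
    using Cons.prems by auto
  moreover have "time (concat_map_tm f xs) \<le> 1 + length xs * (T + m + 1)"
    using Cons by auto
  ultimately show ?case by simp
qed simp

lemma val_member_tm [simp]: "val (member_tm x xs) \<longleftrightarrow> x \<in> set xs"
  by (induction xs) auto

lemma time_member_tm: "time (member_tm x xs) \<le> 1 + length xs"
  by (induction xs) auto

lemma val_remdups_tm [simp]: "val (remdups_tm xs) = remdups xs"
  by (induction xs) auto

lemma time_remdups_tm: "time (remdups_tm xs) \<le> 1 + length xs * (length xs + 2)"
proof (induction xs)
  case (Cons x xs)
  then show ?case using time_member_tm[of x xs] by simp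
qed simp

text \<open>Cruder than one more than the maximum, but subadditivity can be iterated: it bounds the
  length of a whole sum by the lengths of its terms, which is all that a polynomial bound asks
  for.\<close>

lemma bits_add_le: "bits (a + b) \<le> bits a + bits b"
proof -
  have lt: "x < 2 ^ floorlog 2 x" for x :: nat
    using floorlog_leD[of 2 x "floorlog 2 x"] by simp
  show ?thesis
  proof (cases "a = 0 \<or> b = 0")
    case True
    then show ?thesis by (auto simp: bits_def)
  next
    case False
    then have "floorlog 2 a \<noteq> 0" "floorlog 2 b \<noteq> 0"
      by (simp_all add: floorlog_eq_zero_iff)
    then obtain k l where k: "floorlog 2 a = Suc k" and l: "floorlog 2 b = Suc l"
      using not0_implies_Suc by blast
    have "a + b < 2 ^ Suc k + 2 ^ Suc l" using lt[of a] lt[of b] k l by simp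
    also have "\<dots> \<le> 2 ^ (Suc k + Suc l)"
    proof -
      \<comment> \<open>Multiplied by 2, the case x = \<open>2 ^ k\<close>, y = \<open>2 ^ l\<close>
        is the claim. Both are at least 1, because k and l are predecessors of the positive lengths
        of nonzero numbers.\<close>
      have "(x::nat) + y \<le> 2 * x * y" if "1 \<le> x" "1 \<le> y" for x y
      proof -
        have "x * 1 \<le> x * y" "1 * y \<le> x * y" using that by (intro mult_le_mono; simp)+
        then show ?thesis by linarith
      qed
      from this[of "2 ^ k" "2 ^ l"] show ?thesis by (simp add: power_add)
    qed
    finally have "floorlog 2 (a + b) \<le> Suc k + Suc l" by (intro floorlog_leI) auto
    then show ?thesis by (simp add: bits_def k l)
  qed
qed

text \<open>Natural coefficients are nonnegative. This carries the bound for \<open>solve\<close>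
  from the size of a node problem to the size of the whole instance.\<close>

lemma poly_nat_mono:
  fixes p :: "nat poly"
  assumes "x \<le> y"
  shows "poly p x \<le> poly p y"
  using assms by (induction p) (auto intro!: mult_le_mono)

section \<open>Schedules\<close>

lemma set_assignment_iff:
  assumes "distinct (map fst xs)"
  shows "d \<in> set (assignment xs \<rho>) \<longleftrightarrow> (\<exists>p. (\<rho>, p) \<in> set xs \<and> d \<in> set p)"
proof -
  have "(\<rho>, p) \<in> set xs \<longleftrightarrow> map_of xs \<rho> = Some p" for p
    using map_of_eq_Some_iff[OF assms] by simp
  then show ?thesis by (cases "map_of xs \<rho>") (simp_all add: assignment_def)
qed

text \<open>Distinct keys make \<open>map_of\<close> return every listed entry, and an unlisted
  resource has the empty path, which is always a path.\<close>

lemma feasible_assignment_iff: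
  assumes "wf_schedule I xs"
  shows "feasible I (assignment xs) \<longleftrightarrow> (\<forall>(\<rho>, p)\<in>set xs. is_path I \<rho> p)"
proof
  assume f: "feasible I (assignment xs)"
  show "\<forall>(\<rho>, p)\<in>set xs. is_path I \<rho> p"
  proof clarify
    fix r s k p assume "((r, s, k), p) \<in> set xs"
    with assms have "assignment xs (r, s, k) = p" "(r, s, k) \<in> resources I"
      by (force simp: wf_schedule_def assignment_def)+
    with f show "is_path I (r, s, k) p" unfolding feasible_def by blast
  qed
next
  assume p: "\<forall>(\<rho>, p)\<in>set xs. is_path I \<rho> p"
  show "feasible I (assignment xs)"
    unfolding feasible_def
  proof
    fix \<rho>
    show "is_path I \<rho> (assignment xs \<rho>)"
    proof (cases "map_of xs \<rho>")
      case None
      then show ?thesis by (cases \<rho>) (simp add: assignment_def)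
    next
      case (Some q)
      then have "(\<rho>, q) \<in> set xs" by (rule map_of_SomeD)
      with p Some show ?thesis by (auto simp: assignment_def)
    qed
  qed
qed

text \<open>All keys are resources, so the membership condition in \<open>met\<close> is absorbed.
  What remains speaks of entries only and is easily followed through concatenations.\<close>

lemma met_assignment_iff:
  assumes "wf_schedule I xs"
  shows "met I (assignment xs) d \<longleftrightarrow>
    (\<forall>r\<in>req I d. \<exists>s k p. ((r, s, k), p) \<in> set xs \<and> d \<in> set p)"
proof -
  have "distinct (map fst xs)" and key: "(\<rho>, p) \<in> set xs \<Longrightarrow> \<rho> \<in> resources I" for \<rho> p
    using assms by (force simp: wf_schedule_def)+
  then have "\<rho> \<in> resources I \<and> d \<in> set (assignment xs \<rho>) \<longleftrightarrow>
      (\<exists>p. (\<rho>, p) \<in> set xs \<and> d \<in> set p)" for \<rho>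
    unfolding set_assignment_iff[OF \<open>distinct (map fst xs)\<close>] by blast
  then show ?thesis by (simp add: met_def)
qed

text \<open>Disjointness is required for different indices and not for different blocks: the blocks
  of two nodes may both be empty and hence equal.\<close>

lemma distinct_concat_map:
  assumes "distinct xs" "\<And>x. x \<in> set xs \<Longrightarrow> distinct (f x)"
    and "\<And>x y. x \<in> set xs \<Longrightarrow> y \<in> set xs \<Longrightarrow> x \<noteq> y \<Longrightarrow> set (f x) \<inter> set (f y) = {}"
  shows "distinct (concat (map f xs))"
  using assms
proof (induction xs)
  case (Cons x xs)
  have "distinct (concat (map f xs))" using Cons by simp
  moreover have "set (f x) \<inter> set (f y) = {}" if "y \<in> set xs" for y
    using Cons.prems that by (intro Cons.prems(3)) auto
  ultimately show ?case using Cons.prems by auto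
qed simp

section \<open>The optimum\<close>

text \<open>There may be infinitely many feasible assignments, as they are arbitrary outside the
  resources, but their values are natural numbers bounded by the total reward. This makes the
  \<open>Max\<close> in \<open>opt\<close> meaningful.\<close>

lemma finite_objectives:
  assumes "finite (demands I)"
  shows "finite {objective I \<sigma> | \<sigma>. feasible I \<sigma>}"
proof (rule finite_subset)
  show "{objective I \<sigma> | \<sigma>. feasible I \<sigma>} \<subseteq> {..\<Sum>d\<in>demands I. reward I d}"
    using assms by (auto simp: objective_def intro!: sum_mono2)
qed simp

lemma objective_le_opt:
  assumes "finite (demands I)" "feasible I \<sigma>"
  shows "objective I \<sigma> \<le> opt I"
  unfolding opt_def using assms finite_objectives by (intro Max_ge) auto

lemma opt_attained:
  assumes "finite (demands I)"
  obtains \<sigma> where "feasible I \<sigma>" "opt I = objective I \<sigma>"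
proof -
  have "feasible I (\<lambda>_. [])" by (auto simp: feasible_def)
  then have "opt I \<in> {objective I \<sigma> | \<sigma>. feasible I \<sigma>}"
    unfolding opt_def using finite_objectives[OF assms] by (intro Max_in) auto
  with that show thesis by auto
qed

section \<open>The problem of a node\<close>

text \<open>Fixes the demands that \<open>subproblem\<close> leaves open, so that the analysis does
  not refer to the filtered list from which the algorithm builds them.\<close>

definition node_problem :: "('d, 'l) mrmd \<Rightarrow> nat set \<Rightarrow> ('d, 'l) mrmd" where
  "node_problem I v = subproblem I v {d \<in> demands I. req I d = v}"

lemma node_problem_simps [simp]:
  "demands (node_problem I v) = {d \<in> demands I. req I d = v}"
  "types (node_problem I v) = {Min v}"
  "req (node_problem I v) d = {Min v}"
  "starts (node_problem I v) = starts I"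
  "num (node_problem I v) = num I"
  "tau (node_problem I v) = tau I"
  "duration (node_problem I v) = duration I"
  "reward (node_problem I v) = reward I"
  "loc (node_problem I v) = loc I"
  "travel (node_problem I v) = travel I"
  by (simp_all add: node_problem_def subproblem_def)

lemma finite_req: "mrmd_instance I \<Longrightarrow> d \<in> demands I \<Longrightarrow> finite (req I d)"
  by (auto simp: mrmd_instance_def intro: finite_subset)

lemma node_props:
  assumes "mrmd_instance I" "v \<in> req I ` demands I"
  shows "finite v" "v \<noteq> {}" "v \<subseteq> types I" "Min v \<in> v" "Min v \<in> types I"
proof -
  show "finite v" "v \<noteq> {}" "v \<subseteq> types I"
    using assms by (auto simp: mrmd_instance_def intro: finite_subset)
  then show "Min v \<in> v" "Min v \<in> types I" by (auto intro: Min_in)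
qed

lemma node_problem_instance:
  assumes "mrmd_instance I" "v \<in> req I ` demands I"
  shows "mrmd_instance (node_problem I v)" "single_type (node_problem I v)"
  using assms node_props[OF assms] by (auto simp: mrmd_instance_def single_type_def)

lemma resources_node_problem:
  assumes "mrmd_instance I" "v \<in> req I ` demands I"
  shows "resources (node_problem I v) = {(r, s, k) \<in> resources I. r = Min v}"
  using node_props[OF assms] by (auto simp: resources_def)

text \<open>For a transitive relation, being related consecutively is the same as being related
  pairwise, and the latter survives deletions. Transitivity is asked for on S only, because the
  triangle inequality speaks of locations of the instance.\<close>

lemma successively_filter_trans_on:
  assumes "\<And>x y z. x \<in> S \<Longrightarrow> y \<in> S \<Longrightarrow> z \<in> S \<Longrightarrow> R x y \<Longrightarrow> R y z \<Longrightarrow> R x z"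
    and "set p \<subseteq> S" "successively R p"
  shows "successively R (filter P p)"
proof -
  have "successively R p \<longleftrightarrow> sorted_wrt R p"
    using assms(1,2) by (intro successively_iff_sorted_wrt_strong) blast
  with assms(3) have "sorted_wrt R p" by simp
  then have "sorted_wrt R (filter P p)" by (rule sorted_wrt_filter)
  then show ?thesis by (rule successively_if_sorted_wrt)
qed

text \<open>Deleting the demands of other nodes creates new consecutive pairs and possibly a new
  first demand. Both are reached in time because a direct trip is no longer than the detour through
  the deleted demands.\<close>

lemma is_path_node_problem:
  assumes inst: "mrmd_instance I" and tri: "triangle_inequality I"
    and v: "v \<in> req I ` demands I"
    and \<rho>: "(Min v, s, k) \<in> resources I"
    and path: "is_path I (Min v, s, k) p"
  shows "is_path (node_problem I v) (Min v, s, k) (filter (\<lambda>d. req I d = v) p)"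
proof -
  let ?q = "filter (\<lambda>d. req I d = v) p"
  have D: "set p \<subseteq> demands I" and suc: "successively (can_serve_next I (Min v)) p"
    using path by auto
  have locs: "loc I d \<in> locations I" if "d \<in> demands I" for d
    using that by (auto simp: locations_def)
  have sloc: "s \<in> locations I" using \<rho> by (auto simp: locations_def resources_def)
  have tri': "travel I x z \<le> travel I x y + travel I y z"
    if "x \<in> locations I" "y \<in> locations I" "z \<in> locations I" for x y z
    using tri that by (auto simp: triangle_inequality_def)
  \<comment> \<open>The trip from x to z is at most the trip through y, and the service at y only
    adds a further nonnegative delay.\<close>
  have trans: "can_serve_next I r x z"
    if "x \<in> demands I" "y \<in> demands I" "z \<in> demands I"
      "can_serve_next I r x y" "can_serve_next I r y z" for x y z r
    using that tri'[OF locs[of x] locs[of y] locs[of z]] by (auto simp: can_serve_next_def)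
  \<comment> \<open>Any d on the path may become the first demand after the deletions. Its direct
    trip from s is compared with the one through the old head x, which is reached by its start
    time.\<close>
  have first: "travel I s (loc I d) \<le> tau I d" if "d \<in> set p" for d
  proof (cases p)
    case (Cons x q)
    have "successively (can_serve_next I (Min v)) p \<longleftrightarrow> sorted_wrt (can_serve_next I (Min v)) p"
      using trans D by (intro successively_iff_sorted_wrt_strong) blast
    with suc have "sorted_wrt (can_serve_next I (Min v)) p" by simp
    with Cons that have "d = x \<or> can_serve_next I (Min v) x d" by auto
    moreover have "travel I s (loc I x) \<le> tau I x"
      using path Cons by (auto simp: can_serve_first_def)
    moreover have "travel I s (loc I d) \<le> travel I s (loc I x) + travel I (loc I x) (loc I d)"
      using D Cons that by (intro tri' locs sloc) auto
    ultimately show ?thesis by (auto simp: can_serve_next_def)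
  qed (use that in simp)
  have "successively (can_serve_next I (Min v)) ?q"
    by (rule successively_filter_trans_on[OF trans D suc])
  then have "successively (can_serve_next (node_problem I v) (Min v)) ?q"
    by (rule successively_mono) (auto simp: can_serve_next_def)
  moreover have "can_serve_first (node_problem I v) (Min v) s (hd ?q)" if "?q \<noteq> []"
  proof -
    have "hd ?q \<in> set p" using hd_in_set[OF that] by auto
    then show ?thesis using first by (simp add: can_serve_first_def)
  qed
  moreover have "set ?q \<subseteq> demands (node_problem I v)" using D by auto
  ultimately show ?thesis unfolding is_path.simps by blast
qed


lemma opt_le_sum_nodes:
  assumes inst: "mrmd_instance I" and tri: "triangle_inequality I"
  shows "opt I \<le> (\<Sum>v\<in>req I ` demands I. opt (node_problem I v))"
proof -
  have fin: "finite (demands I)" using inst by (simp add: mrmd_instance_def)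
  then obtain \<sigma> where \<sigma>: "feasible I \<sigma>" "opt I = objective I \<sigma>"
    by (rule opt_attained)
  let ?M = "{d \<in> demands I. met I \<sigma> d}"
  have "opt I = (\<Sum>v\<in>req I ` demands I. \<Sum>d | d \<in> ?M \<and> req I d = v. reward I d)"
    unfolding \<sigma>(2) objective_def using fin by (subst sum.group) auto
  also have "\<dots> \<le> (\<Sum>v\<in>req I ` demands I. opt (node_problem I v))"
  proof (rule sum_mono)
    fix v assume v: "v \<in> req I ` demands I"
    define \<tau> where "\<tau> \<rho> = filter (\<lambda>d. req I d = v) (\<sigma> \<rho>)" for \<rho>
    have "feasible (node_problem I v) \<tau>"
      using \<sigma>(1) is_path_node_problem[OF inst tri v]
      by (auto simp: feasible_def resources_node_problem[OF inst v] \<tau>_def simp del: is_path.simps)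
    then have "objective (node_problem I v) \<tau> \<le> opt (node_problem I v)"
      using fin by (intro objective_le_opt) auto
    moreover have "(\<Sum>d | d \<in> ?M \<and> req I d = v. reward I d) \<le> objective (node_problem I v) \<tau>"
      unfolding objective_def node_problem_simps
    proof (rule sum_mono2)
      \<comment> \<open>Being met by all types of v includes being met by \<open>Min v\<close>, the
        only type that is kept. The converse may fail, so the restriction can gain reward but cannot
        lose any.\<close>
      have "met (node_problem I v) \<tau> d" if "d \<in> ?M" "req I d = v" for d
      proof -
        have "\<exists>s k. (Min v, s, k) \<in> resources I \<and> d \<in> set (\<sigma> (Min v, s, k))"
          using that node_props(4)[OF inst v] unfolding met_def by blast
        then show ?thesis
          using that by (simp add: met_def \<tau>_def resources_node_problem[OF inst v])
      qed
      then show "{d. d \<in> ?M \<and> req I d = v}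
          \<subseteq> {d. d \<in> {d \<in> demands I. req I d = v} \<and> met (node_problem I v) \<tau> d}" by auto
    qed (use fin in auto)
    ultimately show "(\<Sum>d | d \<in> ?M \<and> req I d = v. reward I d) \<le> opt (node_problem I v)"
      by simp
  qed
  finally show ?thesis .
qed

section \<open>Replicating schedules\<close>

definition relabel :: "nat \<Rightarrow> 'l resource \<times> 'd list \<Rightarrow> 'l resource \<times> 'd list" where
  "relabel r e = ((r, snd (fst e)), snd e)"

lemma val_copy_path_tm [simp]: "val (copy_path_tm r e) = relabel r e"
  by (cases "(r, e)" rule: copy_path_tm.cases) (simp add: relabel_def)

definition replicated :: "nat set \<Rightarrow> ('d, 'l) schedule \<Rightarrow> ('d, 'l) schedule" where
  "replicated v xs = concat (map (\<lambda>r. map (relabel r) xs) (sorted_list_of_set v))"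

lemma val_replicate_schedule_tm [simp]:
  "val (replicate_schedule_tm (v, xs)) = replicated v xs"
  by (simp add: replicated_def)

declare replicate_schedule_tm.simps [simp del]

lemma in_replicated_iff:
  assumes "finite v"
  shows "((r, s, k), p) \<in> set (replicated v xs) \<longleftrightarrow> r \<in> v \<and> (\<exists>i. ((i, s, k), p) \<in> set xs)"
  using assms by (force simp: replicated_def relabel_def)

text \<open>Relabelling forgets the type of a resource. It is injective on the keys because they all
  share the type i; copies made for different r differ in their first component.\<close>

lemma distinct_replicated:
  assumes "distinct (map fst xs)" and "\<And>\<rho> p. (\<rho>, p) \<in> set xs \<Longrightarrow> fst \<rho> = i"
  shows "distinct (map fst (replicated v xs))"
proof -
  have "distinct (map (\<lambda>e. (r, snd (fst e))) xs)" for r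
  proof -
    have "inj_on (\<lambda>\<rho>. (r, snd \<rho>)) (fst ` set xs)"
    proof (rule inj_onI)
      fix \<rho> \<rho>'
      assume in_xs: "\<rho> \<in> fst ` set xs" "\<rho>' \<in> fst ` set xs" and eq: "(r, snd \<rho>) = (r, snd \<rho>')"
      have "fst (fst e) = i" if "e \<in> set xs" for e
        using assms(2)[of "fst e" "snd e"] that by simp
      then have "fst \<rho> = i" "fst \<rho>' = i" using in_xs by blast+
      then have "fst \<rho> = fst \<rho>'" by simp
      with eq show "\<rho> = \<rho>'" by (simp add: prod_eq_iff)
    qed
    with assms(1) have "distinct (map (\<lambda>\<rho>. (r, snd \<rho>)) (map fst xs))"
      by (subst distinct_map) auto
    then show ?thesis by (simp add: comp_def)
  qed
  then have "distinct (concat (map (\<lambda>r. map (\<lambda>e. (r, snd (fst e))) xs) (sorted_list_of_set v)))"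
    by (intro distinct_concat_map) auto
  then show ?thesis by (simp add: replicated_def relabel_def map_concat comp_def)
qed

(* With a common start s, the resources of type r at s are all resources of type r, so sorted
   labels compare their numbers at s. *)
lemma resource_of_larger_type:
  assumes "mrmd_instance I" "sorted_labels I" "same_start I"
    and res: "(r, s, k) \<in> resources I" and r': "r' \<in> types I" "r \<le> r'"
  shows "(r', s, k) \<in> resources I"
proof -
  have fin: "finite (starts I r)" "finite (starts I r')"
    using assms by (auto simp: mrmd_instance_def resources_def)
  have start: "s' = s" if "s' \<in> starts I r'" "num I r' s' \<noteq> 0" for s'
  proof -
    have "(r', s', 0) \<in> resources I" using that r' by (simp add: resources_def)
    moreover obtain s\<^sub>0 where s0: "\<forall>(r, s, k)\<in>resources I. s = s\<^sub>0"
      using \<open>same_start I\<close> unfolding same_start_def by blast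
    ultimately show ?thesis using bspec[OF s0 res] bspec[OF s0, of "(r', s', 0)"] by simp
  qed
  have "k < num I r s" using res by (simp add: resources_def)
  also have "\<dots> \<le> num_resources I r"
    unfolding num_resources_def using res fin by (intro member_le_sum) (auto simp: resources_def)
  also have "\<dots> \<le> num_resources I r'"
    using assms by (auto simp: sorted_labels_def resources_def)
  also have "\<dots> = (\<Sum>s'\<in>starts I r'. if s' = s then num I r' s else 0)"
    unfolding num_resources_def using start by (intro sum.cong) auto
  finally show ?thesis using fin r' by (auto simp: resources_def sum.delta split: if_splits)
qed

section \<open>The joint schedule of pairwise disjoint nodes\<close>

definition combined :: "(nat set \<Rightarrow> ('d, 'l) schedule) \<Rightarrow> nat set list \<Rightarrow> ('d, 'l) schedule" where
  "combined B S = concat (map (\<lambda>v. replicated v (B v)) S)"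

text \<open>Disjoint nodes have disjoint types, so their blocks have disjoint keys. Within a block
  all types carry the same paths, hence a demand visited by one of its types is visited by all of
  them. This turns the value into an exact sum over the nodes.\<close>

lemma combined_schedule:
  assumes inst: "mrmd_instance I" and labels: "sorted_labels I" and start: "same_start I"
    and S: "distinct S" "set S \<subseteq> req I ` demands I"
    and disj: "\<And>u v. u \<in> set S \<Longrightarrow> v \<in> set S \<Longrightarrow> u \<noteq> v \<Longrightarrow> u \<inter> v = {}"
    and B: "\<And>v. v \<in> set S \<Longrightarrow> wf_schedule (node_problem I v) (B v)"
      "\<And>v. v \<in> set S \<Longrightarrow> feasible (node_problem I v) (assignment (B v))"
  shows "wf_schedule I (combined B S)"
    and "feasible I (assignment (combined B S))"
    and "objective I (assignment (combined B S)) =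
      (\<Sum>v\<leftarrow>S. objective (node_problem I v) (assignment (B v)))"
proof -
  have V: "v \<in> req I ` demands I" if "v \<in> set S" for v using S that by auto
  note props = node_props[OF inst V]
  have key: "(r, s, k) \<in> resources I \<and> r = Min v"
    if "v \<in> set S" "((r, s, k), p) \<in> set (B v)" for v r s k p
    using B(1)[OF that(1)] that(2) resources_node_problem[OF inst V[OF that(1)]]
    by (force simp: wf_schedule_def)
  have path: "is_path (node_problem I v) \<rho> p" if "v \<in> set S" "(\<rho>, p) \<in> set (B v)" for v \<rho> p
    using B that feasible_assignment_iff by blast
  have in_combined: "((r, s, k), p) \<in> set (combined B S) \<longleftrightarrow>
      (\<exists>v\<in>set S. r \<in> v \<and> ((Min v, s, k), p) \<in> set (B v))" for r s k p
  proof -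
    have "((r, s, k), p) \<in> set (combined B S) \<longleftrightarrow>
        (\<exists>v\<in>set S. ((r, s, k), p) \<in> set (replicated v (B v)))"
      by (auto simp: combined_def)
    \<comment> \<open>Replication leaves the type of the original entry open; \<open>key\<close>
      identifies it as \<open>Min v\<close>.\<close>
    also have "\<dots> \<longleftrightarrow> (\<exists>v\<in>set S. r \<in> v \<and> ((Min v, s, k), p) \<in> set (B v))"
      using key props(1) by (simp add: in_replicated_iff) blast
    finally show ?thesis .
  qed
  have demand: "d \<in> demands I \<and> req I d = v"
    if "v \<in> set S" "((i, s, k), p) \<in> set (B v)" "d \<in> set p" for v i s k p d
    using path[OF that(1,2)] that(3) by auto
  show wf: "wf_schedule I (combined B S)"
    unfolding wf_schedule_def
  proof
    have "distinct (concat (map (\<lambda>v. map fst (replicated v (B v))) S))"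
    proof (rule distinct_concat_map)
      fix v assume v: "v \<in> set S"
      show "distinct (map fst (replicated v (B v)))"
      proof (rule distinct_replicated)
        show "distinct (map fst (B v))" using B(1)[OF v] by (simp add: wf_schedule_def)
        show "fst \<rho> = Min v" if "(\<rho>, p) \<in> set (B v)" for \<rho> p
          using key[OF v, of "fst \<rho>" "fst (snd \<rho>)" "snd (snd \<rho>)" p] that by simp
      qed
    next
      fix u v assume uv: "u \<in> set S" "v \<in> set S" "u \<noteq> v"
      have "\<rho> \<notin> set (map fst (replicated v (B v)))"
        if "\<rho> \<in> set (map fst (replicated u (B u)))" for \<rho>
      proof -
        obtain r s k where \<rho>: "\<rho> = (r, s, k)" by (cases \<rho>)
        show ?thesis
          using disj[OF uv] that props(1)[OF uv(1)] props(1)[OF uv(2)]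
          by (auto simp: \<rho> in_replicated_iff)
      qed
      then show "set (map fst (replicated u (B u))) \<inter> set (map fst (replicated v (B v))) = {}"
        by blast
    qed (use S in simp)
    then show "distinct (map fst (combined B S))" by (simp add: combined_def map_concat comp_def)
    have "(r, s, k) \<in> resources I" if "((r, s, k), p) \<in> set (combined B S)" for r s k p
    proof -
      obtain v where v: "v \<in> set S" "r \<in> v" "((Min v, s, k), p) \<in> set (B v)"
        using \<open>((r, s, k), p) \<in> set (combined B S)\<close> in_combined by blast
      have "r \<in> types I" using props(3)[OF v(1)] v(2) by blast
      moreover have "Min v \<le> r" using props(1)[OF v(1)] v(2) by (rule Min_le)
      moreover have "(Min v, s, k) \<in> resources I" using key[OF v(1,3)] by blast
      ultimately show ?thesis using resource_of_larger_type[OF inst labels start] by blast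
    qed
    then show "set (map fst (combined B S)) \<subseteq> resources I" by auto
  qed
  have "is_path I \<rho> p" if in_X: "(\<rho>, p) \<in> set (combined B S)" for \<rho> p
  proof -
    obtain r s k where \<rho>: "\<rho> = (r, s, k)" by (cases \<rho>)
    obtain v where v: "v \<in> set S" "r \<in> v" "((Min v, s, k), p) \<in> set (B v)"
      using in_X unfolding \<rho> in_combined by blast
    have req: "req I d = v" if "d \<in> set p" for d using demand[OF v(1,3) that] by blast
    have J: "successively (can_serve_next (node_problem I v) (Min v)) p"
      "p \<noteq> [] \<Longrightarrow> can_serve_first (node_problem I v) (Min v) s (hd p)"
      using path[OF v(1,3)] by simp_all
    have "successively (can_serve_next I r) p"
    proof (rule successively_mono[OF J(1)])
      fix x y
      assume "x \<in> set p" "y \<in> set p" "can_serve_next (node_problem I v) (Min v) x y"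
      then show "can_serve_next I r x y"
        using v(2) by (simp add: can_serve_next_def req)
    qed
    moreover have "can_serve_first I r s (hd p)" if "p \<noteq> []"
      using J(2)[OF that] req[OF hd_in_set[OF that]] v(2) by (simp add: can_serve_first_def)
    moreover have "set p \<subseteq> demands I" using demand[OF v(1,3)] by blast
    ultimately show ?thesis unfolding \<rho> is_path.simps by blast
  qed
  then show "feasible I (assignment (combined B S))"
    unfolding feasible_assignment_iff[OF wf] by blast
  have met_node: "met (node_problem I v) (assignment (B v)) d \<longleftrightarrow>
      (\<exists>s k p. ((Min v, s, k), p) \<in> set (B v) \<and> d \<in> set p)" if "v \<in> set S" for v d
    using met_assignment_iff[OF B(1)[OF that]] by simp
  have met: "met I (assignment (combined B S)) d \<longleftrightarrow>
      req I d \<in> set S \<and> met (node_problem I (req I d)) (assignment (B (req I d))) d"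
    if d: "d \<in> demands I" for d
  proof
    assume m: "met I (assignment (combined B S)) d"
    \<comment> \<open>One type suffices here: the path found for r was copied from the entry of some
      node v, and a demand on such a path has v as its requirement set.\<close>
    obtain r where "r \<in> req I d" using node_props(2)[OF inst imageI[OF d]] by blast
    then obtain s k p where "((r, s, k), p) \<in> set (combined B S)" "d \<in> set p"
      using m unfolding met_assignment_iff[OF wf] by blast
    then obtain v where v: "v \<in> set S" "((Min v, s, k), p) \<in> set (B v)" "d \<in> set p"
      unfolding in_combined by blast
    then have "req I d = v" using demand by blast
    moreover have "met (node_problem I v) (assignment (B v)) d"
      unfolding met_node[OF v(1)] using v by blast
    ultimately show "req I d \<in> set S \<and>
        met (node_problem I (req I d)) (assignment (B (req I d))) d"
      using v(1) by simp
  next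
    assume m: "req I d \<in> set S \<and> met (node_problem I (req I d)) (assignment (B (req I d))) d"
    \<comment> \<open>The converse direction is replication itself: this one entry has a copy for
      every type in \<open>req I d\<close>.\<close>
    then obtain s k p where "((Min (req I d), s, k), p) \<in> set (B (req I d))" "d \<in> set p"
      using met_node by blast
    with m show "met I (assignment (combined B S)) d"
      unfolding met_assignment_iff[OF wf] in_combined by blast
  qed
  have fin: "finite (demands I)" using inst by (simp add: mrmd_instance_def)
  \<comment> \<open>Every met demand belongs to a node of S by \<open>met\<close>, so grouping over
    S alone loses no reward.\<close>
  have "objective I (assignment (combined B S)) =
      (\<Sum>v\<in>set S. \<Sum>d | d \<in> {d \<in> demands I. met I (assignment (combined B S)) d} \<and> req I d = v.
        reward I d)"
    unfolding objective_def using fin met by (subst sum.group) auto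
  also have "\<dots> = (\<Sum>v\<in>set S. objective (node_problem I v) (assignment (B v)))"
  proof (rule sum.cong)
    fix v assume "v \<in> set S"
    then have "{d. d \<in> {d \<in> demands I. met I (assignment (combined B S)) d} \<and> req I d = v} =
        {d. d \<in> demands (node_problem I v) \<and> met (node_problem I v) (assignment (B v)) d}"
      using met by auto
    then show "(\<Sum>d | d \<in> {d \<in> demands I. met I (assignment (combined B S)) d} \<and> req I d = v.
        reward I d) = objective (node_problem I v) (assignment (B v))"
      unfolding objective_def node_problem_simps by simp
  qed simp
  also have "\<dots> = (\<Sum>v\<leftarrow>S. objective (node_problem I v) (assignment (B v)))"
    using S(1) by (simp add: sum_list_distinct_conv_sum_set)
  finally show "objective I (assignment (combined B S)) =
      (\<Sum>v\<leftarrow>S. objective (node_problem I v) (assignment (B v)))" .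
qed

section \<open>The solution computed by Algorithm B\<close>

text \<open>Increasing lists represent only finite sets faithfully; the requirement sets are finite
  because the set of types is.\<close>

lemma val_subproblem_tm:
  assumes "mrmd_instance I" "v \<in> req I ` demands I"
  shows "val (subproblem_tm I v) = node_problem I v"
proof -
  have "sorted_list_of_set (req I d) = sorted_list_of_set v \<longleftrightarrow> req I d = v"
    if "d \<in> demands I" for d
    using that finite_req[OF assms(1)] node_props(1)[OF assms] sorted_list_of_set_inject by blast
  then have "set (filter (\<lambda>d. sorted_list_of_set (req I d) = sorted_list_of_set v)
      (sorted_list_of_set (demands I))) = {d \<in> demands I. req I d = v}"
    using assms(1) by (auto simp: mrmd_instance_def)
  then show ?thesis by (simp add: subproblem_tm_def Let_def node_problem_def)
qed

lemma val_solve_nodes_tm: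
  assumes "mrmd_instance I" "set S \<subseteq> req I ` demands I"
  shows "val (solve_nodes_tm solve I S) =
    (\<Sum>v\<leftarrow>S. fst (val (solve (node_problem I v))),
     map (\<lambda>v. (v, snd (val (solve (node_problem I v))))) S)"
  using assms(2) by (induction S) (simp_all add: val_subproblem_tm[OF assms(1)] split_beta)

text \<open>The default pair for no colours is the result on the empty list of nodes. Allowing
  \<open>S = []\<close> therefore lets one description of the winner cover this case as
  well.\<close>

lemma best_color_tm_cases:
  obtains S where "S = [] \<or> (\<exists>i. S = filter (\<lambda>v. c v = i) vs)"
    and "val (best_color_tm solve I vs c cs) = val (solve_nodes_tm solve I S)"
    and "\<forall>i\<in>set cs. fst (val (solve_nodes_tm solve I (filter (\<lambda>v. c v = i) vs)))
      \<le> fst (val (solve_nodes_tm solve I S))"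
proof (induction cs arbitrary: thesis)
  case Nil
  show ?case by (rule Nil[of "[]"]) simp_all
next
  case (Cons i cs)
  obtain S where S: "S = [] \<or> (\<exists>i. S = filter (\<lambda>v. c v = i) vs)"
    "val (best_color_tm solve I vs c cs) = val (solve_nodes_tm solve I S)"
    "\<forall>i\<in>set cs. fst (val (solve_nodes_tm solve I (filter (\<lambda>v. c v = i) vs)))
        \<le> fst (val (solve_nodes_tm solve I S))"
    by (rule Cons.IH)
  let ?T = "filter (\<lambda>v. c v = i) vs"
  show ?case
  proof (cases "fst (val (solve_nodes_tm solve I S)) \<le> fst (val (solve_nodes_tm solve I ?T))")
    case True
    with S show ?thesis by (intro Cons.prems[of ?T]) (auto intro: order_trans)
  next
    case False
    with S show ?thesis by (intro Cons.prems[of S]) auto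
  qed
qed

lemma val_algorithm_B:
  "val (algorithm_B solve I vs c) =
    (let W = val (best_color_tm solve I vs c (remdups (map c vs)))
     in (fst W, concat (map (\<lambda>e. val (replicate_schedule_tm e)) (snd W))))"
  by (simp add: algorithm_B_def split_beta Let_def)

lemma solves_single_typeD:
  assumes "solves_single_type solve" "mrmd_instance J" "single_type J"
  shows "wf_schedule J (snd (val (solve J)))"
    and "feasible J (assignment (snd (val (solve J))))"
    and "objective J (assignment (snd (val (solve J)))) = opt J"
    and "fst (val (solve J)) = opt J"
  using assms unfolding solves_single_type_def by (auto simp: split_beta)

text \<open>The ratio is stated as a product of natural numbers. It combines the upper bound by all
  nodes with the exact value of the winning class, which is at least the value of every other
  class.\<close>

lemma algorithm_B_correct:
  assumes solve: "solves_single_type solve"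
    and inst: "mrmd_instance I" and labels: "sorted_labels I"
    and tri: "triangle_inequality I" and start: "same_start I"
    and vs: "distinct vs" "set vs = fst (conflict_graph I)"
    and col: "proper_coloring (conflict_graph I) \<chi> c"
    and result: "val (algorithm_B solve I vs c) = (z, xs)"
  shows "wf_schedule I xs" and "feasible I (assignment xs)"
    and "z = objective I (assignment xs)" and "opt I \<le> \<chi> * z"
proof -
  let ?V = "req I ` demands I"
  define B where "B v = snd (val (solve (node_problem I v)))" for v
  have V: "set vs = ?V" using vs(2) by (simp add: conflict_graph_def Let_def)
  have range: "c v \<in> {1..\<chi>}" if "v \<in> ?V" for v
    using col that by (auto simp: conflict_graph_def Let_def)
  have disj: "u \<inter> v = {}" if "u \<in> ?V" "v \<in> ?V" "u \<noteq> v" "c u = c v" for u v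
  proof (rule ccontr)
    assume "u \<inter> v \<noteq> {}"
    with that have "{u, v} \<in> snd (conflict_graph I)"
      unfolding conflict_graph_def Let_def snd_conv by blast
    with col have "c u \<noteq> c v" by (cases "conflict_graph I") simp
    with that show False by simp
  qed
  note solved = solves_single_typeD[OF solve node_problem_instance[OF inst]]
  let ?f = "\<lambda>S. fst (val (solve_nodes_tm solve I S))"
  have sum_opt: "?f S = (\<Sum>v\<leftarrow>S. opt (node_problem I v))" if "set S \<subseteq> ?V" for S
  proof -
    have "map (\<lambda>v. fst (val (solve (node_problem I v)))) S = map (\<lambda>v. opt (node_problem I v)) S"
      using that by (intro map_cong) (auto simp: solved(4))
    then show ?thesis unfolding val_solve_nodes_tm[OF inst that] by (simp only: fst_conv)
  qed
  obtain S where S: "S = [] \<or> (\<exists>i. S = filter (\<lambda>v. c v = i) vs)"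
    "val (best_color_tm solve I vs c (remdups (map c vs))) = val (solve_nodes_tm solve I S)"
    "\<forall>i\<in>set (remdups (map c vs)). ?f (filter (\<lambda>v. c v = i) vs) \<le> ?f S"
    by (rule best_color_tm_cases)
  have S_props: "distinct S" "set S \<subseteq> ?V" using S(1) vs(1) V by auto
  have S_disj: "u \<inter> v = {}" if "u \<in> set S" "v \<in> set S" "u \<noteq> v" for u v
    using S(1) that V by (intro disj) auto
  have z: "z = ?f S" and xs: "xs = combined B S"
    using result unfolding val_algorithm_B S(2) val_solve_nodes_tm[OF inst S_props(2)]
    by (auto simp: Let_def combined_def B_def comp_def)
  have B: "wf_schedule (node_problem I v) (B v)" "feasible (node_problem I v) (assignment (B v))"
    if "v \<in> set S" for v
    using that S_props(2) solved(1,2) unfolding B_def by auto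
  note comb = combined_schedule[OF inst labels start S_props S_disj B]
  show "wf_schedule I xs" "feasible I (assignment xs)"
    unfolding xs by (rule comb(1), assumption+) (rule comb(2), assumption+)
  have "objective I (assignment xs) =
      (\<Sum>v\<leftarrow>S. objective (node_problem I v) (assignment (B v)))"
    unfolding xs by (rule comb(3), assumption+)
  also have "\<dots> = (\<Sum>v\<leftarrow>S. opt (node_problem I v))"
    using S_props(2) by (intro arg_cong[of _ _ sum_list] map_cong) (auto simp: B_def solved(3))
  also have "\<dots> = z" using z sum_opt S_props(2) by simp
  finally show "z = objective I (assignment xs)" by simp
  have "opt I \<le> (\<Sum>v\<in>?V. opt (node_problem I v))" by (rule opt_le_sum_nodes[OF inst tri])
  \<comment> \<open>Grouping by the colours that occur matches the colours over which the algorithm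
    maximises; there are at most \<chi> of them.\<close>
  also have "\<dots> = (\<Sum>i\<in>c ` ?V. \<Sum>v | v \<in> ?V \<and> c v = i. opt (node_problem I v))"
    by (subst sum.group) (simp_all flip: V)
  also have "\<dots> \<le> (\<Sum>i\<in>c ` ?V. z)"
  proof (rule sum_mono)
    fix i assume i: "i \<in> c ` ?V"
    have "(\<Sum>v | v \<in> ?V \<and> c v = i. opt (node_problem I v)) = ?f (filter (\<lambda>v. c v = i) vs)"
      using vs(1) by (subst sum_opt) (auto simp: V sum_list_distinct_conv_sum_set)
    also have "\<dots> \<le> z" using bspec[OF S(3), of i] i z by (simp add: V)
    finally show "(\<Sum>v | v \<in> ?V \<and> c v = i. opt (node_problem I v)) \<le> z" .
  qed
  also have "\<dots> = card (c ` ?V) * z" by simp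
  also have "\<dots> \<le> \<chi> * z"
  proof (rule mult_le_mono1)
    have "card (c ` ?V) \<le> card {1..\<chi>}" using range by (intro card_mono) auto
    then show "card (c ` ?V) \<le> \<chi>" by simp
  qed
  finally show "opt I \<le> \<chi> * z" .
qed

section \<open>Sizes\<close>

lemma sum_subset_mono_nat:
  fixes f g :: "'a \<Rightarrow> nat"
  assumes "finite B" "A \<subseteq> B" "\<And>x. x \<in> A \<Longrightarrow> f x \<le> g x"
  shows "sum f A \<le> sum g B"
proof -
  have "sum f A \<le> sum g A" using assms(3) by (rule sum_mono)
  also have "\<dots> \<le> sum g B" using assms(1,2) by (intro sum_mono2) auto
  finally show ?thesis .
qed

lemma card_types_le: "card (types I) \<le> inst_size I"
  by (simp add: inst_size_def)

lemma card_demands_le: "card (demands I) \<le> inst_size I"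
proof -
  have "card (demands I) = (\<Sum>d\<in>demands I. 1)" by simp
  also have "\<dots> \<le> (\<Sum>d\<in>demands I.
      1 + card (req I d) + bits (tau I d) + bits (duration I d) + bits (reward I d))"
    by (intro sum_mono) simp
  also have "\<dots> \<le> inst_size I" by (simp add: inst_size_def)
  finally show ?thesis .
qed

lemma card_node_le:
  assumes "mrmd_instance I" "v \<in> req I ` demands I"
  shows "card v \<le> inst_size I"
proof -
  have "card v \<le> card (types I)"
    using node_props(3)[OF assms] assms(1) by (intro card_mono) (auto simp: mrmd_instance_def)
  also have "\<dots> \<le> inst_size I" by (rule card_types_le)
  finally show ?thesis .
qed

text \<open>The groups of summands of \<open>inst_size\<close> are compared one by one; each passes
  to a subset of the indices.\<close>

lemma inst_size_node_problem_le:
  assumes inst: "mrmd_instance I" and v: "v \<in> req I ` demands I"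
  shows "inst_size (node_problem I v) \<le> inst_size I"
proof -
  have fin: "finite (types I)" "finite (demands I)" "finite (locations I)"
    "finite (starts I (Min v))"
    using inst node_props(5)[OF assms] by (auto simp: mrmd_instance_def locations_def)
  have loc: "locations (node_problem I v) \<subseteq> locations I"
    using node_props(5)[OF assms] by (auto simp: locations_def)
  have "card {Min v} \<le> card (types I)"
    using node_props(5)[OF assms] fin by (intro card_mono) auto
  moreover have "(\<Sum>r\<in>{Min v}. \<Sum>s\<in>starts I r. 1 + bits (num I r s)) \<le>
      (\<Sum>r\<in>types I. \<Sum>s\<in>starts I r. 1 + bits (num I r s))"
    using node_props(5)[OF assms] fin by (intro sum_subset_mono_nat) auto
  moreover have "(\<Sum>d | d \<in> demands I \<and> req I d = v. 1 + card {Min v} + bits (tau I d) +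
        bits (duration I d) + bits (reward I d)) \<le>
      (\<Sum>d\<in>demands I. 1 + card (req I d) + bits (tau I d) + bits (duration I d) + bits (reward I d))"
  proof (rule sum_subset_mono_nat)
    fix d assume "d \<in> {d. d \<in> demands I \<and> req I d = v}"
    \<comment> \<open>A requirement set of size 1 replaces v, which is nonempty and hence no
      smaller.\<close>
    then have "card (req I d) > 0"
      using node_props(1,2)[OF assms] by (simp add: card_gt_0_iff)
    then show "1 + card {Min v} + bits (tau I d) + bits (duration I d) + bits (reward I d) \<le>
      1 + card (req I d) + bits (tau I d) + bits (duration I d) + bits (reward I d)" by simp
  qed (use fin in auto)
  moreover have "(\<Sum>x\<in>locations (node_problem I v). \<Sum>y\<in>locations (node_problem I v).
        bits (travel I x y)) \<le> (\<Sum>x\<in>locations I. \<Sum>y\<in>locations I. bits (travel I x y))"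
    using fin loc by (intro sum_subset_mono_nat) auto
  ultimately show ?thesis
    unfolding inst_size_def node_problem_simps by linarith
qed

section \<open>Sizes of schedules and of their copies\<close>

definition entry_size :: "'l resource \<times> 'd list \<Rightarrow> nat" where
  "entry_size e = 1 + bits (snd (snd (fst e))) + length (snd e)"

definition schedule_size :: "('d, 'l) schedule \<Rightarrow> nat" where
  "schedule_size xs = (\<Sum>e\<leftarrow>xs. entry_size e)"

lemma output_size_eq: "output_size zs = bits (fst zs) + schedule_size (snd zs)"
proof -
  have "output_size (z, xs) = bits z + schedule_size xs" for z xs
    by (induction xs) (auto simp: schedule_size_def entry_size_def)
  then show ?thesis by (cases zs) (simp del: output_size.simps)
qed

lemma length_le_schedule_size: "length xs \<le> schedule_size xs"
  by (induction xs) (simp_all add: schedule_size_def entry_size_def)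

lemma entry_size_relabel [simp]: "entry_size (relabel r e) = entry_size e"
  by (simp add: entry_size_def relabel_def)

lemma time_copy_path_tm [simp]: "time (copy_path_tm r e) = entry_size e"
  by (cases "(r, e)" rule: copy_path_tm.cases) (simp add: entry_size_def)

lemma schedule_size_concat:
  "schedule_size (concat xss) = (\<Sum>xs\<leftarrow>xss. schedule_size xs)"
  by (induction xss) (simp_all add: schedule_size_def)

text \<open>A copy keeps the index and the path and so has the size of the original, once for each
  type. Replication thus costs only a factor bounded by the size of the instance.\<close>

lemma schedule_size_replicated:
  "schedule_size (replicated v xs) = card v * schedule_size xs"
proof -
  have "schedule_size (map (relabel r) xs) = schedule_size xs" for r
    by (simp add: schedule_size_def comp_def)
  then show ?thesis
    by (simp add: replicated_def schedule_size_concat comp_def sum_list_triv)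
qed

section \<open>Running time of Algorithm B\<close>

text \<open>Here q bounds the number of entries as well as the cost of copying one. Each type costs
  at most 1 + q * (q + 1) for the copies and q + 1 for appending them.\<close>

lemma time_replicate_schedule_tm:
  assumes "card v \<le> n" "schedule_size xs \<le> q"
  shows "time (replicate_schedule_tm (v, xs)) \<le> 1 + n * (q * (q + 1) + q + 2)"
proof -
  have len: "length xs \<le> q" using length_le_schedule_size assms(2) by (rule order_trans)
  have "time (map_tm (copy_path_tm r) xs) \<le> 1 + q * (q + 1)" for r
  proof -
    have "time (copy_path_tm r e) \<le> q" if "e \<in> set xs" for e
    proof -
      have "entry_size e \<le> schedule_size xs"
        unfolding schedule_size_def using that by (intro member_le_sum_list) auto
      with assms(2) show ?thesis by simp
    qed
    then have "time (map_tm (copy_path_tm r) xs) \<le> 1 + length xs * (q + 1)"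
      by (rule time_map_tm)
    also have "\<dots> \<le> 1 + q * (q + 1)" using len by (intro add_left_mono mult_le_mono1)
    finally show ?thesis .
  qed
  then have "time (replicate_schedule_tm (v, xs)) \<le>
      1 + length (sorted_list_of_set v) * ((1 + q * (q + 1)) + q + 1)"
    unfolding replicate_schedule_tm.simps by (intro time_concat_map_tm) (auto simp: len)
  also have "\<dots> \<le> 1 + n * ((1 + q * (q + 1)) + q + 1)"
    using assms(1) by (intro add_left_mono mult_le_mono1) simp
  finally show ?thesis by (simp add: algebra_simps)
qed

text \<open>At most n demands pass a comparison costing 1 + n, plus one traversal step each; writing
  down the result adds another n.\<close>

lemma time_subproblem_tm:
  assumes inst: "mrmd_instance I" and v: "v \<in> req I ` demands I"
    and n: "inst_size I \<le> n"
  shows "time (subproblem_tm I v) \<le> 1 + n * (n + 3)"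
proof -
  let ?P = "\<lambda>d. list_eq_tm (sorted_list_of_set (req I d)) (sorted_list_of_set v)"
  have "time (?P d) \<le> 1 + n" if "d \<in> set (sorted_list_of_set (demands I))" for d
  proof -
    have "d \<in> demands I" using that inst by (simp add: mrmd_instance_def)
    then have "card (req I d) \<le> n" using card_node_le[OF inst] n by (meson imageI order_trans)
    with time_list_eq_tm[of "sorted_list_of_set (req I d)" "sorted_list_of_set v"]
    show ?thesis by simp
  qed
  then have "time (filter_tm ?P (sorted_list_of_set (demands I))) \<le>
      1 + length (sorted_list_of_set (demands I)) * ((1 + n) + 1)"
    by (rule time_filter_tm)
  also have "\<dots> \<le> 1 + n * ((1 + n) + 1)"
    using card_demands_le[of I] n by (intro add_left_mono mult_le_mono1) simp
  finally have filt: "time (filter_tm ?P (sorted_list_of_set (demands I))) \<le> 1 + n * (n + 2)"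
    by simp
  have "time (subproblem_tm I v) = time (filter_tm ?P (sorted_list_of_set (demands I))) +
      inst_size (val (subproblem_tm I v))"
    by (simp add: subproblem_tm_def Let_def)
  also have "inst_size (val (subproblem_tm I v)) \<le> n"
    using inst_size_node_problem_le[OF inst v] n by (simp add: val_subproblem_tm[OF inst v])
  finally show ?thesis using filt by (simp add: algebra_simps)
qed

text \<open>The constant 1 is the length of 0, the value of the empty sum.\<close>

lemma bits_sum_list_le:
  assumes "\<And>x. x \<in> set xs \<Longrightarrow> bits (f x) \<le> q"
  shows "bits (\<Sum>x\<leftarrow>xs. f x) \<le> 1 + length xs * q"
  using assms
proof (induction xs)
  case Nil
  show ?case by (simp add: bits_def floorlog_eq_zero_iff)
next
  case (Cons x xs)
  have "bits (f x) \<le> q" "bits (\<Sum>x\<leftarrow>xs. f x) \<le> 1 + length xs * q" using Cons by auto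
  then show ?case using bits_add_le[of "f x" "\<Sum>x\<leftarrow>xs. f x"] by simp
qed

text \<open>One node costs 1 + n * (n + 3) for its subproblem, q for solving it, q + (1 + n * q) for
  adding its value to the partial sum, and 1 for the result.\<close>

lemma time_solve_nodes_tm:
  assumes inst: "mrmd_instance I" and S: "set S \<subseteq> req I ` demands I" "length S \<le> n"
    and n: "inst_size I \<le> n"
    and time: "\<And>v. v \<in> req I ` demands I \<Longrightarrow> time (solve (node_problem I v)) \<le> q"
    and bits: "\<And>v. v \<in> req I ` demands I \<Longrightarrow> bits (fst (val (solve (node_problem I v)))) \<le> q"
  shows "time (solve_nodes_tm solve I S) \<le> 1 + length S * (n * (n + 3) + n * q + 2 * q + 3)"
    and "bits (fst (val (solve_nodes_tm solve I S))) \<le> 1 + n * q"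
proof -
  \<comment> \<open>Stated for every list T of nodes, since the induction on time adds to the sum of
    a tail.\<close>
  have bits_sum: "bits (fst (val (solve_nodes_tm solve I T))) \<le> 1 + n * q"
    if "set T \<subseteq> req I ` demands I" "length T \<le> n" for T
  proof -
    have "bits (fst (val (solve_nodes_tm solve I T))) \<le> 1 + length T * q"
      unfolding val_solve_nodes_tm[OF inst that(1)] fst_conv
      using that(1) bits by (intro bits_sum_list_le) blast
    also have "\<dots> \<le> 1 + n * q" using that(2) by simp
    finally show ?thesis .
  qed
  show "bits (fst (val (solve_nodes_tm solve I S))) \<le> 1 + n * q" by (rule bits_sum[OF S])
  show "time (solve_nodes_tm solve I S) \<le> 1 + length S * (n * (n + 3) + n * q + 2 * q + 3)"
    using S
  proof (induction S)
    case (Cons v S)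
    then have v: "v \<in> req I ` demands I" and S: "set S \<subseteq> req I ` demands I" "length S \<le> n"
      by auto
    have "time (solve_nodes_tm solve I (v # S)) =
        time (subproblem_tm I v) + time (solve (node_problem I v)) +
        time (solve_nodes_tm solve I S) + bits (fst (val (solve (node_problem I v)))) +
        bits (fst (val (solve_nodes_tm solve I S))) + 1"
      by (simp add: split_beta val_subproblem_tm[OF inst v])
    then show ?case
      using time_subproblem_tm[OF inst v n] time[OF v] bits[OF v] bits_sum[OF S] Cons.IH[OF S]
      by simp
  qed simp
qed

text \<open>One colour costs 1 + 2 * n for selecting its nodes, 1 + n * \<open>?K\<close> for
  solving them, twice 1 + n * q for the comparison, and 1 for the result.\<close>

lemma time_best_color_tm:
  assumes inst: "mrmd_instance I" and vs: "set vs \<subseteq> req I ` demands I" "length vs \<le> n"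
    and n: "inst_size I \<le> n"
    and time: "\<And>v. v \<in> req I ` demands I \<Longrightarrow> time (solve (node_problem I v)) \<le> q"
    and bits: "\<And>v. v \<in> req I ` demands I \<Longrightarrow> bits (fst (val (solve (node_problem I v)))) \<le> q"
  shows "time (best_color_tm solve I vs c cs) \<le>
    1 + length cs * (2 * n + n * (n * (n + 3) + n * q + 2 * q + 3) + 2 * n * q + 5)"
proof (induction cs)
  case (Cons i cs)
  let ?T = "filter (\<lambda>v. c v = i) vs"
  let ?K = "n * (n + 3) + n * q + 2 * q + 3"
  have T: "set ?T \<subseteq> req I ` demands I" "length ?T \<le> n"
    using vs by (auto intro: order_trans[OF length_filter_le])
  have filt: "time (filter_tm (\<lambda>v. charge 1 (c v = i)) vs) \<le> 1 + 2 * n"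
    using time_filter_tm[of vs "\<lambda>v. charge 1 (c v = i)" 1] vs(2) by simp
  have "length ?T * ?K \<le> n * ?K" using T(2) by (rule mult_le_mono1)
  then have cand: "time (solve_nodes_tm solve I ?T) \<le> 1 + n * ?K"
    "bits (fst (val (solve_nodes_tm solve I ?T))) \<le> 1 + n * q"
    using time_solve_nodes_tm[where solve = solve and q = q, OF inst T n time bits] by linarith+
  \<comment> \<open>The best sum so far is itself the sum over a list of nodes, so the length bound
    for such sums applies to it directly.\<close>
  obtain S where S: "S = [] \<or> (\<exists>i. S = filter (\<lambda>v. c v = i) vs)"
    "val (best_color_tm solve I vs c cs) = val (solve_nodes_tm solve I S)"
    by (rule best_color_tm_cases)
  have "set S \<subseteq> set vs" "length S \<le> length vs" using S(1) by auto
  with vs have "set S \<subseteq> req I ` demands I" "length S \<le> n" by auto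
  then have best: "bits (fst (val (best_color_tm solve I vs c cs))) \<le> 1 + n * q"
    unfolding S(2) using time_solve_nodes_tm(2)[where solve = solve and q = q, OF inst _ _ n time bits] by blast
  have "time (best_color_tm solve I vs c (i # cs)) =
      time (filter_tm (\<lambda>v. charge 1 (c v = i)) vs) + time (solve_nodes_tm solve I ?T) +
      time (best_color_tm solve I vs c cs) +
      bits (fst (val (best_color_tm solve I vs c cs))) +
      bits (fst (val (solve_nodes_tm solve I ?T))) + 1"
    by simp
  then show ?case using filt cand best Cons.IH by simp
qed simp

text \<open>The constant 5 collects the base costs of the four traversals and the final step; all
  other costs are proportional to the number of nodes or colours, which are both at most n. The
  output has one value of at most 1 + n * q bits and at most n blocks of size n * q.\<close>

lemma algorithm_B_polynomial:
  assumes inst: "mrmd_instance I" and vs: "distinct vs" "set vs = req I ` demands I"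
    and n: "inst_size I \<le> n"
    and time: "\<And>v. v \<in> req I ` demands I \<Longrightarrow> time (solve (node_problem I v)) \<le> q"
    and out: "\<And>v. v \<in> req I ` demands I \<Longrightarrow> output_size (val (solve (node_problem I v))) \<le> q"
  defines "K \<equiv> 2 * n + n * (n * (n + 3) + n * q + 2 * q + 3) + 2 * n * q + 5"
  shows "time (algorithm_B solve I vs c) \<le>
      5 + n * (n * (q * (q + 1) + q + 2) + n * q + K + n + 6)"
    and "output_size (val (algorithm_B solve I vs c)) \<le> 1 + n * q + n * (n * q)"
proof -
  define B where "B v = snd (val (solve (node_problem I v)))" for v
  have bits: "bits (fst (val (solve (node_problem I v)))) \<le> q"
    and size: "schedule_size (B v) \<le> q" if "v \<in> req I ` demands I" for v
    using out[OF that] by (simp_all add: B_def output_size_eq)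
  have len: "length vs \<le> n"
  proof -
    have "length vs = card (req I ` demands I)" using vs distinct_card by metis
    also have "\<dots> \<le> card (demands I)"
      using inst by (intro card_image_le) (simp add: mrmd_instance_def)
    also have "\<dots> \<le> inst_size I" by (rule card_demands_le)
    finally show ?thesis using n by simp
  qed
  let ?cs = "remdups (map c vs)"
  let ?W = "val (best_color_tm solve I vs c ?cs)"
  have cs: "length ?cs \<le> n" using length_remdups_leq[of "map c vs"] len by simp
  obtain S where S: "S = [] \<or> (\<exists>i. S = filter (\<lambda>v. c v = i) vs)"
    "?W = val (solve_nodes_tm solve I S)"
    by (rule best_color_tm_cases)
  have "set S \<subseteq> set vs" "length S \<le> length vs" using S(1) by auto
  with vs len have S_props: "set S \<subseteq> req I ` demands I" "length S \<le> n" by auto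
  have W2: "snd ?W = map (\<lambda>v. (v, B v)) S"
    unfolding S(2) val_solve_nodes_tm[OF inst S_props(1)] by (simp add: B_def)
  have W1: "bits (fst ?W) \<le> 1 + n * q"
    unfolding S(2) by (rule time_solve_nodes_tm(2)[where solve = solve and q = q, OF inst S_props n time bits])
  have repl_size: "schedule_size (replicated v (B v)) \<le> n * q" if "v \<in> set S" for v
  proof -
    have v: "v \<in> req I ` demands I" using that S_props(1) by blast
    have "card v \<le> n" using card_node_le[OF inst v] n by simp
    then show ?thesis
      unfolding schedule_size_replicated using size[OF v] by (rule mult_le_mono)
  qed
  have "schedule_size (snd (val (algorithm_B solve I vs c))) =
      (\<Sum>v\<leftarrow>S. schedule_size (replicated v (B v)))"
    by (simp add: val_algorithm_B Let_def W2 schedule_size_concat comp_def)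
  also have "\<dots> \<le> (\<Sum>v\<leftarrow>S. n * q)" using repl_size by (rule sum_list_mono)
  also have "\<dots> = length S * (n * q)" by (simp add: sum_list_triv)
  also have "\<dots> \<le> n * (n * q)" using S_props(2) by (rule mult_le_mono1)
  finally have "schedule_size (snd (val (algorithm_B solve I vs c))) \<le> n * (n * q)" .
  moreover have "fst (val (algorithm_B solve I vs c)) = fst ?W"
    by (simp add: val_algorithm_B Let_def)
  ultimately show "output_size (val (algorithm_B solve I vs c)) \<le> 1 + n * q + n * (n * q)"
    using W1 by (simp add: output_size_eq)
  have t1: "time (map_tm (\<lambda>v. charge 1 (c v)) vs) \<le> 1 + n * 2"
    using time_map_tm[of vs "\<lambda>v. charge 1 (c v)" 1] len by simp
  have "length vs * (length vs + 2) \<le> n * (n + 2)" using len by (intro mult_le_mono) auto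
  then have t2: "time (remdups_tm (map c vs)) \<le> 1 + n * (n + 2)"
    using time_remdups_tm[of "map c vs"] by simp
  have "time (best_color_tm solve I vs c ?cs) \<le> 1 + length ?cs * K"
    unfolding K_def using vs by (intro time_best_color_tm[where solve = solve and q = q, OF inst _ len n time bits]) auto
  also have "\<dots> \<le> 1 + n * K" using cs by (intro add_left_mono mult_le_mono1)
  finally have t3: "time (best_color_tm solve I vs c ?cs) \<le> 1 + n * K" .
  let ?R = "1 + n * (q * (q + 1) + q + 2)"
  have "time (concat_map_tm replicate_schedule_tm (snd ?W)) \<le> 1 + length (snd ?W) * (?R + n * q + 1)"
  proof (rule time_concat_map_tm)
    fix e assume "e \<in> set (snd ?W)"
    then obtain v where v: "v \<in> set S" "e = (v, B v)" by (auto simp: W2)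
    with S_props(1) have V: "v \<in> req I ` demands I" by blast
    show "time (replicate_schedule_tm e) \<le> ?R"
      unfolding v(2) using card_node_le[OF inst V] n size[OF V]
      by (intro time_replicate_schedule_tm) auto
    show "length (val (replicate_schedule_tm e)) \<le> n * q"
      unfolding v(2) val_replicate_schedule_tm
      using length_le_schedule_size repl_size[OF v(1)] by (rule order_trans)
  qed
  also have "\<dots> \<le> 1 + n * (?R + n * q + 1)"
    using S_props(2) by (intro add_left_mono mult_le_mono1) (simp add: W2)
  finally have t4: "time (concat_map_tm replicate_schedule_tm (snd ?W)) \<le> 1 + n * (?R + n * q + 1)" .
  have "time (algorithm_B solve I vs c) =
      time (map_tm (\<lambda>v. charge 1 (c v)) vs) + time (remdups_tm (map c vs)) +
      time (best_color_tm solve I vs c ?cs) +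
      time (concat_map_tm replicate_schedule_tm (snd ?W)) + 1"
    by (simp add: algorithm_B_def split_beta)
  also have "\<dots> \<le> (1 + n * 2) + (1 + n * (n + 2)) + (1 + n * K) + (1 + n * (?R + n * q + 1)) + 1"
    using t1 t2 t3 t4 by linarith
  also have "\<dots> = 5 + n * (n * (q * (q + 1) + q + 2) + n * q + K + n + 6)"
    by (simp add: algebra_simps)
  finally show "time (algorithm_B solve I vs c) \<le>
      5 + n * (n * (q * (q + 1) + q + 2) + n * q + K + n + 6)" .
qed

theorem theorem9:
  fixes solve :: "('d::linorder, 'l) mrmd \<Rightarrow> (nat \<times> ('d, 'l) schedule) tm"
  assumes "solves_single_type solve"
  shows "approximation_algorithm
    (\<lambda>(I, vs, \<chi>, c). real \<chi>)
    {(I, vs, \<chi>, c).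
       mrmd_instance I \<and> sorted_labels I \<and> triangle_inequality I \<and> same_start I \<and>
       distinct vs \<and> set vs = fst (conflict_graph I) \<and>
       1 \<le> \<chi> \<and> proper_coloring (conflict_graph I) \<chi> c}
    (\<lambda>(I, vs, \<chi>, c). I)
    (\<lambda>(I, vs, \<chi>, c). algorithm_B solve I vs c)"
proof -
  let ?X = "{(I, vs, \<chi>, c).
       mrmd_instance I \<and> sorted_labels I \<and> triangle_inequality I \<and> same_start I \<and>
       distinct vs \<and> set vs = fst (conflict_graph I) \<and>
       1 \<le> \<chi> \<and> proper_coloring (conflict_graph I) \<chi> (c :: nat set \<Rightarrow> nat)}
     :: (('d, 'l) mrmd \<times> nat set list \<times> nat \<times> (nat set \<Rightarrow> nat)) set"
  have correct: "1 \<le> real \<chi> \<and>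
      (case val (algorithm_B solve I vs c) of (z, xs) \<Rightarrow>
         wf_schedule I xs \<and> feasible I (assignment xs) \<and> z = objective I (assignment xs) \<and>
         1 / real \<chi> * real (opt I) \<le> real (objective I (assignment xs)))"
    if "(I, vs, \<chi>, c) \<in> ?X" for I vs \<chi> c
  proof -
    obtain z xs where result: "val (algorithm_B solve I vs c) = (z, xs)" by fastforce
    from that have \<chi>: "1 \<le> \<chi>" by simp
    have B: "wf_schedule I xs" "feasible I (assignment xs)" "z = objective I (assignment xs)"
      "opt I \<le> \<chi> * z"
      using that algorithm_B_correct[OF assms _ _ _ _ _ _ _ result, of \<chi>] by simp_all
    have "real (opt I) \<le> real \<chi> * real z" using B(4) by (metis of_nat_le_iff of_nat_mult)
    then have "1 / real \<chi> * real (opt I) \<le> real z" using \<chi> by (simp add: field_simps)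
    with B \<chi> result show ?thesis by simp
  qed
  \<comment> \<open>This polynomial depends on \<open>solve\<close> alone, so the bound derived from
    it is uniform in the instance, \<chi> and the colouring.\<close>
  obtain p :: "nat poly" where p: "time (solve J) \<le> poly p (inst_size J)"
    "output_size (val (solve J)) \<le> poly p (inst_size J)"
    if "mrmd_instance J" "single_type J" for J
    using assms unfolding solves_single_type_def polynomial_time_def by blast
  define X K where "X = [:0, 1 :: nat:]"
    and "K = [:2:] * X + X * (X * (X + [:3:]) + X * p + [:2:] * p + [:3:]) + [:2:] * X * p + [:5:]"
  \<comment> \<open>The bounds for time and output with the indeterminate for n and p for q. They
    are added because one polynomial has to dominate both.\<close>
  define P where "P = [:5:] + X * (X * (p * (p + 1) + p + [:2:]) + X * p + K + X + [:6:])
    + (1 + X * p + X * (X * p))"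
  let ?T = "\<lambda>n q. 5 + n * (n * (q * (q + 1) + q + 2) + n * q +
      (2 * n + n * (n * (n + 3) + n * q + 2 * q + 3) + 2 * n * q + 5) + n + 6)"
  let ?S = "\<lambda>n q. 1 + n * q + n * (n * q)"
  have P: "poly P n = ?T n (poly p n) + ?S n (poly p n)" for n
    by (simp add: P_def K_def X_def algebra_simps)
  have poly_time: "time (algorithm_B solve I vs c) \<le> poly P (inst_size I) \<and>
      output_size (val (algorithm_B solve I vs c)) \<le> poly P (inst_size I)"
    if "(I, vs, \<chi>, c) \<in> ?X" for I vs \<chi> c
  proof -
    have inst: "mrmd_instance I" and "distinct vs" "set vs = req I ` demands I"
      using that by (auto simp: conflict_graph_def Let_def)
    moreover have "time (solve (node_problem I v)) \<le> poly p (inst_size I)"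
      "output_size (val (solve (node_problem I v))) \<le> poly p (inst_size I)"
      if "v \<in> req I ` demands I" for v
      using p[OF node_problem_instance[OF inst that]]
        poly_nat_mono[OF inst_size_node_problem_le[OF inst that], of p] by linarith+
    ultimately have "time (algorithm_B solve I vs c) \<le> ?T (inst_size I) (poly p (inst_size I))"
      "output_size (val (algorithm_B solve I vs c)) \<le> ?S (inst_size I) (poly p (inst_size I))"
      using algorithm_B_polynomial[OF inst _ _ order_refl, of vs solve "poly p (inst_size I)" c]
      by blast+
    then show ?thesis unfolding P by (blast intro: trans_le_add1 trans_le_add2)
  qed
  show ?thesis
    unfolding approximation_algorithm_def
  proof (intro conjI ballI)
    show "polynomial_time ?X (inst_size \<circ> (\<lambda>(I, vs, \<chi>, c). I)) output_size
        (\<lambda>(I, vs, \<chi>, c). algorithm_B solve I vs c)"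
      unfolding polynomial_time_def
    proof (intro exI[of _ P] ballI)
      fix x assume x: "x \<in> ?X"
      obtain I vs \<chi> c where "x = (I, vs, \<chi>, c)" by (cases x)
      with poly_time[of I vs \<chi> c] x show
        "time (case x of (I, vs, \<chi>, c) \<Rightarrow> algorithm_B solve I vs c) \<le>
          poly P ((inst_size \<circ> (\<lambda>(I, vs, \<chi>, c). I)) x) \<and>
        output_size (val (case x of (I, vs, \<chi>, c) \<Rightarrow> algorithm_B solve I vs c)) \<le>
          poly P ((inst_size \<circ> (\<lambda>(I, vs, \<chi>, c). I)) x)"
        by (simp only: comp_apply prod.case)
    qed
  next
    fix x assume x: "x \<in> ?X"
    obtain I vs \<chi> c where xe: "x = (I, vs, \<chi>, c)" by (cases x)
    from correct[OF x[unfolded xe]] show "1 \<le> (case x of (I, vs, \<chi>, c) \<Rightarrow> real \<chi>)"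
      unfolding xe by simp
    from correct[OF x[unfolded xe]] show
      "case val (case x of (I, vs, \<chi>, c) \<Rightarrow> algorithm_B solve I vs c) of (z, xs) \<Rightarrow>
         wf_schedule (case x of (I, vs, \<chi>, c) \<Rightarrow> I) xs \<and>
         feasible (case x of (I, vs, \<chi>, c) \<Rightarrow> I) (assignment xs) \<and>
         z = objective (case x of (I, vs, \<chi>, c) \<Rightarrow> I) (assignment xs) \<and>
         1 / (case x of (I, vs, \<chi>, c) \<Rightarrow> real \<chi>) * real (opt (case x of (I, vs, \<chi>, c) \<Rightarrow> I))
           \<le> real (objective (case x of (I, vs, \<chi>, c) \<Rightarrow> I) (assignment xs))"
      unfolding xe prod.case by (rule conjunct2)
  qed
qed

end
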